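(* Let $X_\star\in\mathbf{S}^n$ be any positive semidefinite matrix of rank $r_\star$, with eigenvalue decomposition $X_\star=\sum_{i=1}^n\lambda_i v_iv_i^\top$, where $\lambda_1\ge\cdots\ge\lambda_{r_\star}>\lambda_{r_\star+1}=\cdots=\lambda_n=0$ and $v_1,\dots,v_n$ is an orthonormal basis of $\mathbb{R}^n$. Then the semidefinite program with variable $X\in\mathbf{S}^n$ $$\begin{array}{lll}\text{minimize} & \operatorname{tr}(X) & \\ \text{subject to} & \operatorname{tr}(v_iv_i^\top X)=\lambda_i, & i=1,\dots,r_\star,\\ & \operatorname{tr}\!\left(\frac{v_iv_j^\top+v_jv_i^\top}{2}X\right)=0, & 1\le i<j\le r_\star,\\ & X\succeq 0 & \end{array}$$ is simple and has $X_\star$ as its unique solution.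
   Context: $\mathbf{S}^n$ is the space of real symmetric $n\times n$ matrices with the trace inner product $\langle X,Y\rangle=\operatorname{tr}(X^\top Y)$. Consider a standard form SDP (P): minimize $\langle C,X\rangle$ subject to $\mathcal{A}X=b$, $X\succeq0$, with variable $X\in\mathbf{S}^n$, where $C\in\mathbf{S}^n$, $b\in\mathbb{R}^m$, and $[\mathcal{A}X]_i=\langle A_i,X\rangle$ for $i=1,\dots,m$ with fixed $A_i\in\mathbf{S}^n$. Its dual (D) is: maximize $\langle b,y\rangle$ subject to $C-\mathcal{A}^*y\succeq0$, with variable $y\in\mathbb{R}^m$, where $\mathcal{A}^*y=\sum_i y_iA_i$. "Solution" means optimal solution. - Strong duality: a primal-dual solution pair exists, and for any solution pair $(X_\star,y_\star)$ of (P) and (D), $\operatorname{tr}(CX_\star)=b^\top y_\star$. - Surjective constraint map: $\mathcal{A}:\mathbf{S}^n\to\mathbb{R}^m$ is surjective, equivalently the matrices $A_i$ are linearly independent. - Strict complementarity: there is a solution pair $(X_\star,y_\star)$ of (P) and (D) with $\operatorname{rank}(X_\star)+\operatorname{rank}(C-\mathcal{A}^*y_\star)=n$. - (P) is simple if it satisfies strong duality, has a surjective constraint map, satisfies strict complementarity, and both (P) and (D) have unique solutions. *)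

theory Defs
  imports "HOL-Analysis.Analysis"
begin

definition sym_mats :: "(real^'n^'n) set" where
  "sym_mats = {X. transpose X = X}"

definition trace_inner :: "real^'n^'n \<Rightarrow> real^'n^'n \<Rightarrow> real" where
  "trace_inner X Y = trace (transpose X ** Y)"

definition psd :: "real^'n^'n \<Rightarrow> bool" where
  "psd X \<longleftrightarrow> X \<in> sym_mats \<and> (\<forall>x. x \<bullet> (X *v x) \<ge> 0)"

definition outer :: "real^'n \<Rightarrow> real^'n \<Rightarrow> real^'n^'n" where
  "outer v w = (\<chi> i j. v $ i * w $ j)"

definition orthonormal_basis :: "'i set \<Rightarrow> ('i \<Rightarrow> real^'n) \<Rightarrow> bool" where
  "orthonormal_basis I v \<longleftrightarrow>
     (\<forall>i\<in>I. \<forall>j\<in>I. v i \<bullet> v j = (if i = j then 1 else 0)) \<and> span (v ` I) = UNIV"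

text \<open>
  The constraints are indexed by a finite set \<open>idx\<close> of arbitrary, possibly zero, size \<open>m\<close>.
  A vector of \<open>\<real>\<^sup>m\<close> is represented by a function in the extensional space
  \<open>idx \<rightarrow>\<^sub>E UNIV\<close>: its value outside \<open>idx\<close> is fixed, so that equality of functions is equality
  of vectors and uniqueness of dual solutions has its usual meaning.
\<close>

record ('i, 'n) sdp =
  idx :: "'i set"
  cost :: "real^'n^'n"
  cmat :: "'i \<Rightarrow> real^'n^'n"
  rhs :: "'i \<Rightarrow> real"

definition standard_form :: "('i, 'n::finite) sdp \<Rightarrow> bool" where
  "standard_form P \<longleftrightarrow>
     finite (idx P) \<and> cost P \<in> sym_mats \<and> (\<forall>i\<in>idx P. cmat P i \<in> sym_mats)"

definition dual_space :: "('i, 'n::finite) sdp \<Rightarrow> ('i \<Rightarrow> real) set" where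
  "dual_space P = (idx P \<rightarrow>\<^sub>E UNIV)"

definition constraint_map :: "('i, 'n::finite) sdp \<Rightarrow> real^'n^'n \<Rightarrow> 'i \<Rightarrow> real" where
  "constraint_map P X = (\<lambda>i\<in>idx P. trace_inner (cmat P i) X)"

definition constraint_adjoint :: "('i, 'n::finite) sdp \<Rightarrow> ('i \<Rightarrow> real) \<Rightarrow> real^'n^'n" where
  "constraint_adjoint P y = (\<Sum>i\<in>idx P. y i *\<^sub>R cmat P i)"

definition primal_objective :: "('i, 'n::finite) sdp \<Rightarrow> real^'n^'n \<Rightarrow> real" where
  "primal_objective P X = trace_inner (cost P) X"

definition dual_objective :: "('i, 'n::finite) sdp \<Rightarrow> ('i \<Rightarrow> real) \<Rightarrow> real" where
  "dual_objective P y = (\<Sum>i\<in>idx P. rhs P i * y i)"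

definition dual_slack :: "('i, 'n::finite) sdp \<Rightarrow> ('i \<Rightarrow> real) \<Rightarrow> real^'n^'n" where
  "dual_slack P y = cost P - constraint_adjoint P y"

definition primal_feasible :: "('i, 'n::finite) sdp \<Rightarrow> real^'n^'n \<Rightarrow> bool" where
  "primal_feasible P X \<longleftrightarrow>
     X \<in> sym_mats \<and> (\<forall>i\<in>idx P. constraint_map P X i = rhs P i) \<and> psd X"

definition dual_feasible :: "('i, 'n::finite) sdp \<Rightarrow> ('i \<Rightarrow> real) \<Rightarrow> bool" where
  "dual_feasible P y \<longleftrightarrow> y \<in> dual_space P \<and> psd (dual_slack P y)"

definition primal_solution :: "('i, 'n::finite) sdp \<Rightarrow> real^'n^'n \<Rightarrow> bool" where
  "primal_solution P X \<longleftrightarrow>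
     primal_feasible P X \<and>
     (\<forall>Z. primal_feasible P Z \<longrightarrow> primal_objective P X \<le> primal_objective P Z)"

definition dual_solution :: "('i, 'n::finite) sdp \<Rightarrow> ('i \<Rightarrow> real) \<Rightarrow> bool" where
  "dual_solution P y \<longleftrightarrow>
     dual_feasible P y \<and>
     (\<forall>z. dual_feasible P z \<longrightarrow> dual_objective P z \<le> dual_objective P y)"

definition strong_duality :: "('i, 'n::finite) sdp \<Rightarrow> bool" where
  "strong_duality P \<longleftrightarrow>
     (\<exists>X y. primal_solution P X \<and> dual_solution P y) \<and>
     (\<forall>X y. primal_solution P X \<and> dual_solution P y \<longrightarrow>
        primal_objective P X = dual_objective P y)"

definition surjective_constraint_map :: "('i, 'n::finite) sdp \<Rightarrow> bool" where
  "surjective_constraint_map P \<longleftrightarrow> constraint_map P ` sym_mats = dual_space P"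

definition strict_complementarity :: "('i, 'n::finite) sdp \<Rightarrow> bool" where
  "strict_complementarity P \<longleftrightarrow>
     (\<exists>X y. primal_solution P X \<and> dual_solution P y \<and>
        rank X + rank (dual_slack P y) = CARD('n))"

definition simple_sdp :: "('i, 'n::finite) sdp \<Rightarrow> bool" where
  "simple_sdp P \<longleftrightarrow>
     standard_form P \<and> strong_duality P \<and> surjective_constraint_map P \<and>
     strict_complementarity P \<and> (\<exists>!X. primal_solution P X) \<and> (\<exists>!y. dual_solution P y)"

text \<open>
  Trace minimization over the positive semidefinite matrices that agree, as
  quadratic forms, with \<open>\<Sum>\<^sub>i lam\<^sub>i v\<^sub>i v\<^sub>i\<^sup>T\<close> on the span of \<open>v\<^sub>1, \<dots>, v\<^sub>r\<close>.
  The pair \<open>(i, i)\<close> indexes the constraint on \<open>v\<^sub>i v\<^sub>i\<^sup>T\<close>, the pair \<open>(i, j)\<close> with \<open>i < j\<close> the one on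
  \<open>(v\<^sub>i v\<^sub>j\<^sup>T + v\<^sub>j v\<^sub>i\<^sup>T) / 2\<close>.
\<close>

definition trace_sdp ::
    "nat \<Rightarrow> (nat \<Rightarrow> real) \<Rightarrow> (nat \<Rightarrow> real^'n) \<Rightarrow> (nat \<times> nat, 'n::finite) sdp" where
  "trace_sdp r lam v =
     \<lparr> idx = {(i, j). 1 \<le> i \<and> i \<le> j \<and> j \<le> r},
       cost = mat 1,
       cmat = (\<lambda>(i, j). if i = j then outer (v i) (v i)
                         else (1/2) *\<^sub>R (outer (v i) (v j) + outer (v j) (v i))),
       rhs = (\<lambda>(i, j). if i = j then lam i else 0) \<rparr>"

lemma transpose_outer: "transpose (outer v w) = outer w v"
  by (simp add: transpose_def outer_def vec_eq_iff)

lemma transpose_outer_sum: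
  "transpose ((1/2) *\<^sub>R (outer v w + outer w v)) = (1/2) *\<^sub>R (outer v w + outer w v)"
  by (simp add: transpose_def outer_def vec_eq_iff)

lemma primal_objective_trace_sdp: "primal_objective (trace_sdp r lam v) X = trace X"
  by (simp add: primal_objective_def trace_sdp_def trace_inner_def)

lemma primal_feasible_trace_sdp:
  "primal_feasible (trace_sdp r lam v) X \<longleftrightarrow>
     (\<forall>i. 1 \<le> i \<and> i \<le> r \<longrightarrow> trace (outer (v i) (v i) ** X) = lam i) \<and>
     (\<forall>i j. 1 \<le> i \<and> i < j \<and> j \<le> r \<longrightarrow>
        trace (((1/2) *\<^sub>R (outer (v i) (v j) + outer (v j) (v i))) ** X) = 0) \<and>
     psd X"
  (is "?L \<longleftrightarrow> ?R")
proof -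
  have "?L \<longleftrightarrow> psd X \<and> (\<forall>i j. 1 \<le> i \<and> i \<le> j \<and> j \<le> r \<longrightarrow>
      (if i = j then trace (outer (v i) (v i) ** X) = lam i
       else trace (((1/2) *\<^sub>R (outer (v i) (v j) + outer (v j) (v i))) ** X) = 0))"
    by (auto simp: primal_feasible_def constraint_map_def trace_sdp_def trace_inner_def
        psd_def transpose_outer transpose_outer_sum)
  also have "\<dots> \<longleftrightarrow> ?R"
    by (auto simp: le_less)
  finally show ?thesis .
qed

end

theory Submission
  imports Defs
begin

text \<open>
  Write \<open>X\<close> in the coordinates of the basis \<open>v\<close>, with entries \<open>v\<^sub>i \<bullet> X v\<^sub>j\<close>. For symmetric \<open>X\<close> the
  constraint with index \<open>(i, j)\<close> prescribes the entry \<open>(i, j)\<close>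
  (\<open>constraint_map_trace_sdp\<close>), so the program fixes the leading \<open>r \<times> r\<close> block to
  \<open>diag(lam\<^sub>1, \<dots>, lam\<^sub>r)\<close> and minimizes the sum of the diagonal. What is left of the trace after
  \<open>lam\<^sub>1 + \<dots> + lam\<^sub>r\<close> is the sum of the remaining diagonal entries, which are nonnegative. It is
  zero only if all of them vanish; a positive semidefinite matrix annihilates every vector on which
  its quadratic form vanishes (\<open>psd_mult_eq_0\<close>), so then \<open>X v\<^sub>i = 0\<close> for \<open>i > r\<close>, which forces
  \<open>X = X\<^sub>s\<close>.

  The same argument settles the dual. In the coordinates of \<open>v\<close> the slack matrix of \<open>y\<close> has diagonal
  entries \<open>1 - y\<^sub>i\<^sub>i\<close> and off-diagonal entries \<open>-y\<^sub>i\<^sub>j / 2\<close> in its leading block, and the dual objective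
  is \<open>\<Sum>\<^sub>i lam\<^sub>i y\<^sub>i\<^sub>i\<close>. Feasibility gives \<open>y\<^sub>i\<^sub>i \<le> 1\<close>. As \<open>lam\<^sub>i > 0\<close>, the bound \<open>\<Sum>\<^sub>i lam\<^sub>i\<close> is attained
  only if \<open>y\<^sub>i\<^sub>i = 1\<close> for all \<open>i\<close>, and then the slack annihilates \<open>v\<^sub>1, \<dots>, v\<^sub>r\<close>, so \<open>y\<^sub>i\<^sub>j = 0\<close> for
  \<open>i < j\<close>. The slack of this dual solution is the orthogonal projection onto the span of
  \<open>v\<^sub>r\<^sub>+\<^sub>1, \<dots>, v\<^sub>n\<close>, of rank \<open>n - r\<close>, whence strict complementarity. The constraint map is surjective
  because the constraint matrices are pairwise orthogonal and nonzero
  (\<open>cmat_trace_sdp_coordinates\<close>).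
\<close>

section \<open>Symmetric and positive semidefinite matrices\<close>

lemma trace_inner_eq_inner: "trace_inner X Y = X \<bullet> Y"
  unfolding trace_inner_def trace_def matrix_matrix_mult_def transpose_def inner_vec_def
  by (simp, rule sum.swap)

lemma outer_mult: "outer v w *v x = (w \<bullet> x) *\<^sub>R v"
  by (simp add: outer_def matrix_vector_mult_def vec_eq_iff inner_vec_def sum_distrib_left
      mult_ac)

lemma trace_inner_outer: "trace_inner (outer v w) X = v \<bullet> (X *v w)"
  by (simp add: trace_inner_eq_inner inner_vec_def outer_def matrix_vector_mult_def
      sum_distrib_left mult_ac)

lemma outer_self_sym: "outer v v \<in> sym_mats"
  by (simp add: sym_mats_def transpose_outer)

lemma subspace_sym_mats: "subspace sym_mats"
  by (simp add: subspace_def sym_mats_def transpose_def vec_eq_iff)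

lemma mat_1_sym: "mat 1 \<in> sym_mats"
  by (simp add: sym_mats_def)

lemma sym_mats_inner_commute:
  assumes "X \<in> sym_mats"
  shows "v \<bullet> (X *v w) = w \<bullet> (X *v v)"
proof -
  have "v \<bullet> (X *v w) = (transpose X *v v) \<bullet> w"
    by (simp only: transpose_matrix_vector dot_lmul_matrix)
  also have "\<dots> = w \<bullet> (X *v v)"
    using assms by (simp add: sym_mats_def inner_commute)
  finally show ?thesis .
qed

lemma sum_matrix_vector_mult:
  fixes f :: "'i \<Rightarrow> real^'n^'m"
  shows "(\<Sum>i\<in>I. f i) *v x = (\<Sum>i\<in>I. f i *v x)"
  by (induction I rule: infinite_finite_induct) (simp_all add: matrix_vector_mult_add_rdistrib)

lemma psd_mult_eq_0:
  assumes S: "psd S" and x: "x \<bullet> (S *v x) = 0"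
  shows "S *v x = 0"
proof (rule ccontr)
  define y where "y = S *v x"
  define a where "a = y \<bullet> y"
  define c where "c = y \<bullet> (S *v y)"
  define t where "t = - a / (c + 1)"
  assume "S *v x \<noteq> 0"
  then have a: "a > 0"
    by (simp add: a_def y_def)
  have c: "c \<ge> 0"
    using S by (simp add: psd_def c_def)
  have xy: "x \<bullet> (S *v y) = a"
    using S sym_mats_inner_commute[of S x y] by (simp add: psd_def a_def y_def)
  have t: "t * c = - a - t" and "t < 0"
    using a c by (simp_all add: t_def field_simps)
  \<comment> \<open>Along the line through \<open>x\<close> in direction \<open>S x\<close> the quadratic form is \<open>2at + ct\<^sup>2\<close>, which is
    negative for small \<open>t < 0\<close>; the chosen \<open>t\<close> is small enough.\<close>
  have "0 \<le> (x + t *\<^sub>R y) \<bullet> (S *v (x + t *\<^sub>R y))"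
    using S by (simp add: psd_def)
  also have "\<dots> = 2 * t * a + t * (t * c)"
    using x xy
    by (simp add: matrix_vector_mult_scaleR a_def c_def algebra_simps flip: y_def)
  also have "\<dots> = t * (a - t)"
    unfolding t by (simp add: algebra_simps)
  also have "\<dots> < 0"
    using a \<open>t < 0\<close> by (intro mult_neg_pos) auto
  finally show False by simp
qed

section \<open>Orthonormal bases\<close>

lemma orthonormal_basis_inner:
  "orthonormal_basis I v \<Longrightarrow> i \<in> I \<Longrightarrow> j \<in> I \<Longrightarrow> v i \<bullet> v j = (if i = j then 1 else 0)"
  by (simp add: orthonormal_basis_def)

lemma orthonormal_basis_vec_eqI:
  assumes "orthonormal_basis I v" and "\<And>i. i \<in> I \<Longrightarrow> v i \<bullet> x = v i \<bullet> y"
  shows "x = y"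
proof -
  have "orthogonal (x - y) (x - y)"
  proof (rule orthogonal_to_span)
    show "x - y \<in> span (v ` I)"
      using assms(1) by (simp add: orthonormal_basis_def)
    show "orthogonal (x - y) z" if "z \<in> v ` I" for z
      using that assms(2) by (auto simp: orthogonal_def inner_diff inner_commute)
  qed
  then show ?thesis
    by (simp add: orthogonal_def)
qed

lemma orthonormal_basis_matrix_eqI:
  assumes "orthonormal_basis I v" and "\<And>i. i \<in> I \<Longrightarrow> A *v v i = B *v v i"
  shows "A = B"
proof -
  have "A *v x = B *v x" for x
  proof (rule linear_eq_on_span[where f = "(*v) A" and g = "(*v) B"])
    show "linear ((*v) A)" "linear ((*v) B)"
      by simp_all
    show "x \<in> span (v ` I)"
      using assms(1) by (simp add: orthonormal_basis_def)
  qed (use assms(2) in auto)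
  then show ?thesis
    by (simp add: matrix_eq)
qed

lemma spectral_sum_mult:
  assumes v: "orthonormal_basis I v" and "finite I" "J \<subseteq> I" and j: "j \<in> I"
  shows "(\<Sum>i\<in>J. c i *\<^sub>R outer (v i) (v i)) *v v j = (if j \<in> J then c j *\<^sub>R v j else 0)"
proof -
  have "(\<Sum>i\<in>J. c i *\<^sub>R outer (v i) (v i)) *v v j = (\<Sum>i\<in>J. if i = j then c i *\<^sub>R v i else 0)"
    unfolding sum_matrix_vector_mult
    by (intro sum.cong refl)
      (use assms in \<open>auto simp: outer_mult orthonormal_basis_inner
        simp flip: scaleR_matrix_vector_assoc\<close>)
  also have "\<dots> = (if j \<in> J then c j *\<^sub>R v j else 0)"
    using finite_subset[OF \<open>J \<subseteq> I\<close> \<open>finite I\<close>] by simp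
  finally show ?thesis .
qed

lemma mat_1_eq_sum_outer:
  assumes "orthonormal_basis I v" and "finite I"
  shows "mat 1 = (\<Sum>i\<in>I. outer (v i) (v i))"
  using spectral_sum_mult[OF assms order_refl, where c = "\<lambda>_. 1"]
  by (intro orthonormal_basis_matrix_eqI[OF assms(1)]) simp

lemma trace_eq_sum_orthonormal_basis:
  assumes "orthonormal_basis I v" and "finite I"
  shows "trace X = (\<Sum>i\<in>I. v i \<bullet> (X *v v i))"
proof -
  have "trace X = trace_inner (mat 1) X"
    by (simp add: trace_inner_def)
  also have "\<dots> = (\<Sum>i\<in>I. v i \<bullet> (X *v v i))"
    by (simp add: mat_1_eq_sum_outer[OF assms] trace_inner_eq_inner inner_sum_left
        flip: trace_inner_outer)
  finally show ?thesis .
qed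

lemma psd_sum_outer: "psd (\<Sum>i\<in>J. outer (v i) (v i))"
  unfolding psd_def
proof (intro conjI allI)
  show "(\<Sum>i\<in>J. outer (v i) (v i)) \<in> sym_mats"
    by (intro subspace_sum subspace_sym_mats outer_self_sym)
  show "0 \<le> x \<bullet> ((\<Sum>i\<in>J. outer (v i) (v i)) *v x)" for x
    by (auto simp: sum_matrix_vector_mult outer_mult inner_sum_right inner_commute
        intro!: sum_nonneg)
qed

lemma rank_sum_outer:
  assumes v: "orthonormal_basis I v" and I: "finite I" and J: "J \<subseteq> I"
  shows "rank (\<Sum>i\<in>J. outer (v i) (v i)) = card J"
proof -
  let ?S = "\<Sum>i\<in>J. outer (v i) (v i)"
  have S: "?S *v v j = (if j \<in> J then v j else 0)" if "j \<in> I" for j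
    using spectral_sum_mult[OF v I J that, where c = "\<lambda>_. 1"] by simp
  have "range ((*v) ?S) = (*v) ?S ` span (v ` I)"
    using v by (simp add: orthonormal_basis_def)
  also have "\<dots> = span ((*v) ?S ` v ` I)"
    by (simp add: linear_span_image)
  also have "\<dots> = span (v ` J)"
  proof (rule span_eq[THEN iffD2], intro conjI)
    have "?S *v v j \<in> span (v ` J)" if "j \<in> I" for j
      using S[OF that] by (simp add: span_base span_zero)
    then show "(*v) ?S ` v ` I \<subseteq> span (v ` J)"
      by blast
    have "v j \<in> (*v) ?S ` v ` I" if "j \<in> J" for j
    proof (rule image_eqI)
      show "v j = ?S *v v j"
        using S[of j] that J by auto
    qed (use that J in auto)
    then show "v ` J \<subseteq> span ((*v) ?S ` v ` I)"
      by (auto intro: span_base)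
  qed
  finally have range: "range ((*v) ?S) = span (v ` J)" .
  have inj: "inj_on v J"
  proof (rule inj_onI)
    fix i j assume ij: "i \<in> J" "j \<in> J" "v i = v j"
    then have "i \<in> I" "j \<in> I"
      using J by auto
    then show "i = j"
      using orthonormal_basis_inner[OF v, of i j] orthonormal_basis_inner[OF v, of j j] ij
      by (simp split: if_splits)
  qed
  have "independent (v ` J)"
  proof (rule pairwise_orthogonal_independent)
    show "pairwise orthogonal (v ` J)"
      using v J by (auto simp: pairwise_def orthogonal_def orthonormal_basis_def subset_iff)
    show "0 \<notin> v ` J"
      using v J by (force simp: orthonormal_basis_def)
  qed
  then have "dim (span (v ` J)) = card (v ` J)"
    by (simp add: dim_eq_card_independent)
  then show ?thesis
    by (simp add: rank_dim_range range card_image[OF inj])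
qed

section \<open>The trace minimization program in coordinates\<close>

lemma idx_trace_sdp: "p \<in> idx (trace_sdp r lam v) \<longleftrightarrow> 1 \<le> fst p \<and> fst p \<le> snd p \<and> snd p \<le> r"
  by (auto simp: trace_sdp_def)

lemma finite_idx_trace_sdp: "finite (idx (trace_sdp r lam v))"
  by (rule finite_subset[of _ "{1..r} \<times> {1..r}"]) (auto simp: idx_trace_sdp)

lemma cmat_trace_sdp_sym: "cmat (trace_sdp r lam v) p \<in> sym_mats"
  by (cases p) (auto simp: trace_sdp_def sym_mats_def transpose_outer transpose_outer_sum)

lemma standard_form_trace_sdp: "standard_form (trace_sdp r lam v)"
  unfolding standard_form_def
  by (simp add: finite_idx_trace_sdp cmat_trace_sdp_sym) (simp add: trace_sdp_def mat_1_sym)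

lemma constraint_adjoint_sym: "constraint_adjoint (trace_sdp r lam v) y \<in> sym_mats"
  unfolding constraint_adjoint_def
  by (intro subspace_sum subspace_scale subspace_sym_mats cmat_trace_sdp_sym)

lemma constraint_map_trace_sdp:
  assumes "X \<in> sym_mats" and "(i, j) \<in> idx (trace_sdp r lam v)"
  shows "constraint_map (trace_sdp r lam v) X (i, j) = v i \<bullet> (X *v v j)"
proof -
  have "trace_inner (cmat (trace_sdp r lam v) (i, j)) X = v i \<bullet> (X *v v j)"
    using sym_mats_inner_commute[OF assms(1), of "v j" "v i"]
      trace_inner_outer[of "v i" "v j" X] trace_inner_outer[of "v j" "v i" X]
      trace_inner_outer[of "v i" "v i" X]
    by (auto simp: trace_sdp_def trace_inner_eq_inner inner_add_left)
  then show ?thesis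
    using assms(2) by (simp add: constraint_map_def)
qed

lemma primal_feasible_coordinates:
  "primal_feasible (trace_sdp r lam v) X \<longleftrightarrow>
     psd X \<and> (\<forall>i\<in>{1..r}. \<forall>j\<in>{1..r}. v i \<bullet> (X *v v j) = (if i = j then lam i else 0))"
  (is "?L \<longleftrightarrow> ?R")
proof (cases "psd X")
  case True
  then have sym: "X \<in> sym_mats"
    by (simp add: psd_def)
  have rhs: "rhs (trace_sdp r lam v) (i, j) = (if i = j then lam i else 0)" for i j
    by (simp add: trace_sdp_def)
  have "?L \<longleftrightarrow> (\<forall>(i, j)\<in>idx (trace_sdp r lam v).
      v i \<bullet> (X *v v j) = (if i = j then lam i else 0))"
    using True sym by (auto simp: primal_feasible_def constraint_map_trace_sdp rhs)
  also have "\<dots> \<longleftrightarrow> (\<forall>i\<in>{1..r}. \<forall>j\<in>{1..r}. i \<le> j \<longrightarrow>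
      v i \<bullet> (X *v v j) = (if i = j then lam i else 0))"
    by (force simp: idx_trace_sdp)
  also have "\<dots> \<longleftrightarrow> (\<forall>i\<in>{1..r}. \<forall>j\<in>{1..r}. v i \<bullet> (X *v v j) = (if i = j then lam i else 0))"
    using sym_mats_inner_commute[OF sym] by (metis nle_le)
  finally show ?thesis
    using True by simp
qed (simp add: primal_feasible_def)

text \<open>
  Since the entry \<open>(k, l)\<close> of a symmetric matrix is its trace inner product with the constraint
  matrix \<open>(k, l)\<close>, this computes the Gram matrix of the constraint matrices: it is diagonal with
  nonzero diagonal.
\<close>

lemma cmat_trace_sdp_coordinates:
  assumes v: "orthonormal_basis I v" and I: "{1..r} \<subseteq> I"
    and p: "(i, j) \<in> idx (trace_sdp r lam v)" and q: "(k, l) \<in> idx (trace_sdp r lam v)"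
  shows "v k \<bullet> (cmat (trace_sdp r lam v) (i, j) *v v l) =
    (if (i, j) = (k, l) then (if k = l then 1 else 1 / 2) else 0)"
proof -
  have "i \<in> {1..r}" "j \<in> {1..r}" "k \<in> {1..r}" "l \<in> {1..r}" "i \<le> j" "k \<le> l"
    using p q by (auto simp: idx_trace_sdp)
  moreover from this have "i \<in> I" "j \<in> I" "k \<in> I" "l \<in> I"
    using I by blast+
  ultimately show ?thesis
    using orthonormal_basis_inner[OF v]
    by (auto simp: trace_sdp_def outer_mult matrix_vector_mult_add_rdistrib inner_add_right
        simp flip: scaleR_matrix_vector_assoc)
qed

lemma constraint_adjoint_coordinates:
  assumes v: "orthonormal_basis I v" and I: "{1..r} \<subseteq> I"
    and q: "(k, l) \<in> idx (trace_sdp r lam v)"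
  shows "v k \<bullet> (constraint_adjoint (trace_sdp r lam v) y *v v l) =
    (if k = l then y (k, l) else y (k, l) / 2)"
proof -
  let ?P = "trace_sdp r lam v"
  have "v k \<bullet> (constraint_adjoint ?P y *v v l) =
      (\<Sum>p\<in>idx ?P. y p * (v k \<bullet> (cmat ?P p *v v l)))"
    by (simp add: constraint_adjoint_def sum_matrix_vector_mult inner_sum_right
        flip: scaleR_matrix_vector_assoc)
  also have "\<dots> = (\<Sum>p\<in>idx ?P. if p = (k, l) then y p * (if k = l then 1 else 1 / 2) else 0)"
  proof (intro sum.cong refl)
    fix p assume "p \<in> idx ?P"
    then show "y p * (v k \<bullet> (cmat ?P p *v v l)) =
        (if p = (k, l) then y p * (if k = l then 1 else 1 / 2) else 0)"
      using cmat_trace_sdp_coordinates[OF v I _ q, of "fst p" "snd p"] by simp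
  qed
  also have "\<dots> = (if k = l then y (k, l) else y (k, l) / 2)"
    using q finite_idx_trace_sdp[of r lam v] by simp
  finally show ?thesis .
qed

lemma surjective_constraint_map_trace_sdp:
  assumes v: "orthonormal_basis I v" and I: "{1..r} \<subseteq> I"
  shows "surjective_constraint_map (trace_sdp r lam v)"
proof -
  let ?P = "trace_sdp r lam v"
  have "y \<in> constraint_map ?P ` sym_mats" if y: "y \<in> dual_space ?P" for y
  proof
    \<comment> \<open>The factor 2 compensates for the squared norm 1/2 of the off-diagonal
      constraint matrices.\<close>
    define z where "z p = (if fst p = snd p then y p else 2 * y p)" for p
    let ?X = "constraint_adjoint ?P z"
    show sym: "?X \<in> sym_mats"
      by (rule constraint_adjoint_sym)
    have "y (i, j) = constraint_map ?P ?X (i, j)" if "(i, j) \<in> idx ?P" for i j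
      using constraint_map_trace_sdp[OF sym that] constraint_adjoint_coordinates[OF v I that, of z]
      by (auto simp: z_def)
    then show "y = constraint_map ?P ?X"
      using y by (auto simp: dual_space_def constraint_map_def intro!: PiE_ext)
  qed
  moreover have "constraint_map ?P X \<in> dual_space ?P" for X
    by (simp add: dual_space_def constraint_map_def)
  ultimately show ?thesis
    by (auto simp: surjective_constraint_map_def)
qed

lemma dual_slack_coordinates:
  assumes v: "orthonormal_basis I v" and I: "{1..r} \<subseteq> I"
    and q: "(k, l) \<in> idx (trace_sdp r lam v)"
  shows "v k \<bullet> (dual_slack (trace_sdp r lam v) y *v v l) =
    (if k = l then 1 - y (k, l) else - y (k, l) / 2)"
proof -
  have "cost (trace_sdp r lam v) = mat 1"
    by (simp add: trace_sdp_def)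
  moreover have "v k \<bullet> v l = (if k = l then 1 else 0)"
    using q I by (intro orthonormal_basis_inner[OF v]) (auto simp: idx_trace_sdp)
  ultimately show ?thesis
    using constraint_adjoint_coordinates[OF assms, of y]
    by (simp add: dual_slack_def matrix_vector_mult_diff_rdistrib inner_diff_right)
qed

text \<open>A sum over the constraints whose off-diagonal terms vanish runs over the diagonal.\<close>

lemma sum_idx_trace_sdp_diagonal:
  assumes "\<And>i j. (i, j) \<in> idx (trace_sdp r lam v) \<Longrightarrow> i \<noteq> j \<Longrightarrow> f (i, j) = 0"
  shows "(\<Sum>p\<in>idx (trace_sdp r lam v). f p) = (\<Sum>i=1..r. f (i, i))"
proof -
  have "(\<Sum>p\<in>idx (trace_sdp r lam v). f p) = (\<Sum>p\<in>(\<lambda>i. (i, i)) ` {1..r}. f p)"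
    by (rule sum.mono_neutral_right[OF finite_idx_trace_sdp])
      (auto simp: idx_trace_sdp intro!: assms)
  also have "\<dots> = (\<Sum>i=1..r. f (i, i))"
    by (subst sum.reindex) (auto simp: inj_on_def)
  finally show ?thesis .
qed

lemma dual_objective_trace_sdp:
  "dual_objective (trace_sdp r lam v) y = (\<Sum>i=1..r. lam i * y (i, i))"
  unfolding dual_objective_def
  by (subst sum_idx_trace_sdp_diagonal) (auto simp: trace_sdp_def)

section \<open>The primal solution\<close>

lemma trace_primal_feasible:
  assumes v: "orthonormal_basis {1..n} v" and r: "r \<le> n"
    and X: "primal_feasible (trace_sdp r lam v) X"
  shows "trace X = (\<Sum>i=1..r. lam i) + (\<Sum>i=r+1..n. v i \<bullet> (X *v v i))"
proof -
  have "trace X = (\<Sum>i=1..n. v i \<bullet> (X *v v i))"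
    by (rule trace_eq_sum_orthonormal_basis[OF v]) simp
  also have "{1..n} = {1..r} \<union> {r+1..n}"
    using r by auto
  also have "(\<Sum>i\<in>\<dots>. v i \<bullet> (X *v v i)) =
      (\<Sum>i=1..r. v i \<bullet> (X *v v i)) + (\<Sum>i=r+1..n. v i \<bullet> (X *v v i))"
    by (rule sum.union_disjoint) auto
  also have "(\<Sum>i=1..r. v i \<bullet> (X *v v i)) = (\<Sum>i=1..r. lam i)"
    using X by (simp add: primal_feasible_coordinates)
  finally show ?thesis .
qed

lemma trace_primal_feasible_ge:
  assumes "orthonormal_basis {1..n} v" and "r \<le> n"
    and X: "primal_feasible (trace_sdp r lam v) X"
  shows "(\<Sum>i=1..r. lam i) \<le> trace X"
proof -
  have "0 \<le> (\<Sum>i=r+1..n. v i \<bullet> (X *v v i))"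
    using X by (intro sum_nonneg) (simp add: primal_feasible_def psd_def)
  then show ?thesis
    using trace_primal_feasible[OF assms] by simp
qed

lemma primal_feasible_minimal_trace:
  assumes v: "orthonormal_basis {1..n} v" and r: "r \<le> n"
    and X: "primal_feasible (trace_sdp r lam v) X" and tr: "trace X = (\<Sum>i=1..r. lam i)"
  shows "X = (\<Sum>i=1..r. lam i *\<^sub>R outer (v i) (v i))"
proof -
  have psd: "psd X"
    using X by (simp add: primal_feasible_def)
  have "(\<Sum>i=r+1..n. v i \<bullet> (X *v v i)) = 0"
    using trace_primal_feasible[OF v r X] tr by simp
  then have "\<forall>i\<in>{r+1..n}. v i \<bullet> (X *v v i) = 0"
    using psd by (subst (asm) sum_nonneg_eq_0_iff) (auto simp: psd_def)
  then have ker: "X *v v i = 0" if "i \<in> {r+1..n}" for i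
    using that psd_mult_eq_0[OF psd] by blast
  have eig: "X *v v j = lam j *\<^sub>R v j" if j: "j \<in> {1..r}" for j
  proof (rule orthonormal_basis_vec_eqI[OF v])
    fix i assume i: "i \<in> {1..n}"
    have ij: "v i \<bullet> v j = (if i = j then 1 else 0)"
      using i j r by (intro orthonormal_basis_inner[OF v]) auto
    show "v i \<bullet> (X *v v j) = v i \<bullet> (lam j *\<^sub>R v j)"
    proof (cases "i \<le> r")
      case True
      then show ?thesis
        using X i j ij by (auto simp: primal_feasible_coordinates)
    next
      case False
      then have "X *v v i = 0"
        using i by (intro ker) auto
      then show ?thesis
        using False j ij psd sym_mats_inner_commute[of X "v i" "v j"] by (auto simp: psd_def)
    qed
  qed
  show ?thesis
  proof (rule orthonormal_basis_matrix_eqI[OF v])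
    fix j assume j: "j \<in> {1..n}"
    have "(\<Sum>i=1..r. lam i *\<^sub>R outer (v i) (v i)) *v v j =
        (if j \<in> {1..r} then lam j *\<^sub>R v j else 0)"
      by (rule spectral_sum_mult[OF v _ _ j]) (use r in auto)
    then show "X *v v j = (\<Sum>i=1..r. lam i *\<^sub>R outer (v i) (v i)) *v v j"
      using j eig[of j] ker[of j] by auto
  qed
qed

lemma primal_solution_trace_sdp:
  assumes v: "orthonormal_basis {1..n} v" and r: "r \<le> n"
    and psd: "psd X\<^sub>s" and Xs: "X\<^sub>s = (\<Sum>i=1..r. lam i *\<^sub>R outer (v i) (v i))"
  shows "primal_solution (trace_sdp r lam v) X \<longleftrightarrow> X = X\<^sub>s"
    and "trace X\<^sub>s = (\<Sum>i=1..r. lam i)"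
proof -
  let ?P = "trace_sdp r lam v"
  have Xs_v: "X\<^sub>s *v v j = (if j \<in> {1..r} then lam j *\<^sub>R v j else 0)" if "j \<in> {1..n}" for j
    unfolding Xs by (rule spectral_sum_mult[OF v _ _ that]) (use r in auto)
  have feas: "primal_feasible ?P X\<^sub>s"
    unfolding primal_feasible_coordinates
    using psd Xs_v r orthonormal_basis_inner[OF v] by auto
  have "(\<Sum>i=r+1..n. v i \<bullet> (X\<^sub>s *v v i)) = 0"
    using Xs_v by (intro sum.neutral) auto
  then show tr: "trace X\<^sub>s = (\<Sum>i=1..r. lam i)"
    using trace_primal_feasible[OF v r feas] by simp
  have "primal_solution ?P X\<^sub>s"
    using feas trace_primal_feasible_ge[OF v r]
    by (simp add: primal_solution_def primal_objective_trace_sdp tr)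
  moreover have "X = X\<^sub>s" if sol: "primal_solution ?P X"
  proof -
    have X: "primal_feasible ?P X"
      using sol by (simp add: primal_solution_def)
    have "trace X \<le> trace X\<^sub>s"
      using sol feas by (simp add: primal_solution_def primal_objective_trace_sdp)
    then have "trace X = (\<Sum>i=1..r. lam i)"
      using trace_primal_feasible_ge[OF v r X] tr by simp
    then show ?thesis
      using primal_feasible_minimal_trace[OF v r X] Xs by simp
  qed
  ultimately show "primal_solution ?P X \<longleftrightarrow> X = X\<^sub>s"
    by blast
qed

section \<open>The dual solution\<close>

text \<open>The dual vector that is 1 on the diagonal constraints and 0 on the off-diagonal ones.\<close>

definition diag_dual :: "nat \<Rightarrow> nat \<times> nat \<Rightarrow> real" where
  "diag_dual r = (\<lambda>p\<in>{(i, j). 1 \<le> i \<and> i \<le> j \<and> j \<le> r}. if fst p = snd p then 1 else 0)"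

lemma diag_dual_apply:
  "(i, j) \<in> idx (trace_sdp r lam v) \<Longrightarrow> diag_dual r (i, j) = (if i = j then 1 else 0)"
  by (simp add: diag_dual_def idx_trace_sdp)

lemma diag_dual_in_dual_space: "diag_dual r \<in> dual_space (trace_sdp r lam v)"
  by (simp add: diag_dual_def dual_space_def trace_sdp_def)

lemma dual_slack_diag_dual:
  assumes v: "orthonormal_basis {1..n} v" and r: "r \<le> n"
  shows "dual_slack (trace_sdp r lam v) (diag_dual r) = (\<Sum>i=r+1..n. outer (v i) (v i))"
proof -
  have "constraint_adjoint (trace_sdp r lam v) (diag_dual r) =
      (\<Sum>i=1..r. diag_dual r (i, i) *\<^sub>R cmat (trace_sdp r lam v) (i, i))"
    unfolding constraint_adjoint_def
    by (rule sum_idx_trace_sdp_diagonal) (simp add: diag_dual_apply)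
  also have "\<dots> = (\<Sum>i=1..r. outer (v i) (v i))"
    by (intro sum.cong refl) (simp add: diag_dual_def trace_sdp_def)
  finally have adj: "constraint_adjoint (trace_sdp r lam v) (diag_dual r) =
      (\<Sum>i=1..r. outer (v i) (v i))" .
  have "cost (trace_sdp r lam v) = (\<Sum>i=1..n. outer (v i) (v i))"
    using mat_1_eq_sum_outer[OF v] by (simp add: trace_sdp_def)
  also have "{1..n} = {1..r} \<union> {r+1..n}"
    using r by auto
  also have "(\<Sum>i\<in>\<dots>. outer (v i) (v i)) =
      (\<Sum>i=1..r. outer (v i) (v i)) + (\<Sum>i=r+1..n. outer (v i) (v i))"
    by (rule sum.union_disjoint) auto
  finally show ?thesis
    by (simp add: dual_slack_def adj)
qed

lemma dual_feasible_diag_le: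
  assumes v: "orthonormal_basis {1..n} v" and r: "r \<le> n"
    and y: "dual_feasible (trace_sdp r lam v) y" and i: "i \<in> {1..r}"
  shows "y (i, i) \<le> 1"
proof -
  let ?S = "dual_slack (trace_sdp r lam v) y"
  have "0 \<le> v i \<bullet> (?S *v v i)"
    using y by (simp add: dual_feasible_def psd_def)
  also have "\<dots> = 1 - y (i, i)"
    using dual_slack_coordinates[OF v, of r i i lam y] r i by (simp add: idx_trace_sdp)
  finally show ?thesis by simp
qed

lemma dual_feasible_diag_1:
  assumes v: "orthonormal_basis {1..n} v" and r: "r \<le> n"
    and y: "dual_feasible (trace_sdp r lam v) y" and diag: "\<And>i. i \<in> {1..r} \<Longrightarrow> y (i, i) = 1"
  shows "y = diag_dual r"
proof -
  let ?P = "trace_sdp r lam v"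
  let ?S = "dual_slack ?P y"
  have I: "{1..r} \<subseteq> {1..n}"
    using r by auto
  have psd: "psd ?S"
    using y by (simp add: dual_feasible_def)
  have ker: "?S *v v i = 0" if i: "i \<in> {1..r}" for i
  proof (rule psd_mult_eq_0[OF psd])
    show "v i \<bullet> (?S *v v i) = 0"
      using dual_slack_coordinates[OF v I, of i i lam y] i diag[OF i]
      by (simp add: idx_trace_sdp)
  qed
  have "y p = diag_dual r p" if p: "p \<in> idx ?P" for p
  proof (cases p)
    case (Pair i j)
    then have "j \<in> {1..r}"
      using p by (auto simp: idx_trace_sdp)
    then show ?thesis
      using dual_slack_coordinates[OF v I, of i j lam y] ker[of j] p Pair
      by (simp add: diag_dual_apply split: if_splits)
  qed
  then show ?thesis
    using y diag_dual_in_dual_space[of r lam v]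
    by (intro PiE_ext[of y "idx ?P" "\<lambda>_. UNIV"]) (auto simp: dual_feasible_def dual_space_def)
qed

lemma dual_objective_diag_dual:
  "dual_objective (trace_sdp r lam v) (diag_dual r) = (\<Sum>i=1..r. lam i)"
  unfolding dual_objective_trace_sdp by (intro sum.cong refl) (simp add: diag_dual_def)

lemma dual_solution_trace_sdp:
  assumes v: "orthonormal_basis {1..n} v" and r: "r \<le> n"
    and pos: "\<And>i. i \<in> {1..r} \<Longrightarrow> lam i > 0"
  shows "dual_solution (trace_sdp r lam v) y \<longleftrightarrow> y = diag_dual r"
proof -
  let ?P = "trace_sdp r lam v"
  have feas: "dual_feasible ?P (diag_dual r)"
    by (simp add: dual_feasible_def diag_dual_in_dual_space dual_slack_diag_dual[OF v r]
        psd_sum_outer)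
  have "dual_objective ?P z \<le> dual_objective ?P (diag_dual r)" if z: "dual_feasible ?P z" for z
    unfolding dual_objective_diag_dual unfolding dual_objective_trace_sdp
  proof (rule sum_mono)
    fix i assume "i \<in> {1..r}"
    then show "lam i * z (i, i) \<le> lam i"
      using dual_feasible_diag_le[OF v r z] pos by (simp add: mult_le_cancel_left1 less_imp_le)
  qed
  then have sol: "dual_solution ?P (diag_dual r)"
    using feas by (simp add: dual_solution_def)
  moreover have "y = diag_dual r" if y: "dual_solution ?P y"
  proof (rule dual_feasible_diag_1[OF v r])
    show y_feas: "dual_feasible ?P y"
      using y by (simp add: dual_solution_def)
    have nonneg: "0 \<le> lam i * (1 - y (i, i))" if "i \<in> {1..r}" for i
      using dual_feasible_diag_le[OF v r y_feas that] pos[OF that] by simp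
    have "(\<Sum>i=1..r. lam i) \<le> (\<Sum>i=1..r. lam i * y (i, i))"
      using y feas
      unfolding dual_solution_def dual_objective_diag_dual[of r lam v, symmetric]
        dual_objective_trace_sdp[of r lam v y, symmetric]
      by blast
    then have "(\<Sum>i=1..r. lam i * (1 - y (i, i))) \<le> 0"
      by (simp add: right_diff_distrib sum_subtractf)
    then have "(\<Sum>i=1..r. lam i * (1 - y (i, i))) = 0"
      using nonneg by (intro antisym sum_nonneg) auto
    then have "\<forall>i\<in>{1..r}. lam i * (1 - y (i, i)) = 0"
      using nonneg by (subst (asm) sum_nonneg_eq_0_iff) auto
    then show "y (i, i) = 1" if "i \<in> {1..r}" for i
      using that pos[OF that] by fastforce
  qed
  ultimately show ?thesis
    by blast
qed

section \<open>Simplicity\<close>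

theorem theorem1:
  fixes X\<^sub>s :: "real^'n^'n"
    and r :: nat
    and lam :: "nat \<Rightarrow> real"
    and v :: "nat \<Rightarrow> real^'n"
  assumes "psd X\<^sub>s"
    and "rank X\<^sub>s = r"
    and "orthonormal_basis {1..CARD('n)} v"
    and "X\<^sub>s = (\<Sum>i=1..CARD('n). lam i *\<^sub>R outer (v i) (v i))"
    and "\<And>i j. 1 \<le> i \<Longrightarrow> i \<le> j \<Longrightarrow> j \<le> r \<Longrightarrow> lam j \<le> lam i"
    and "\<And>i. 1 \<le> i \<Longrightarrow> i \<le> r \<Longrightarrow> lam i > 0"
    and "\<And>i. r < i \<Longrightarrow> i \<le> CARD('n) \<Longrightarrow> lam i = 0"
  shows "simple_sdp (trace_sdp r lam v) \<and>
         (\<forall>X. primal_solution (trace_sdp r lam v) X \<longleftrightarrow> X = X\<^sub>s)"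
proof -
  let ?P = "trace_sdp r lam v"
  note v = assms(3)
  have r: "r \<le> CARD('n)"
    using assms(2) rank_bound[of X\<^sub>s] by simp
  have Xs: "X\<^sub>s = (\<Sum>i=1..r. lam i *\<^sub>R outer (v i) (v i))"
    unfolding assms(4) using r assms(7) by (intro sum.mono_neutral_right) auto
  note primal = primal_solution_trace_sdp[OF v r assms(1) Xs]
  have dual: "dual_solution ?P y \<longleftrightarrow> y = diag_dual r" for y
    by (rule dual_solution_trace_sdp[OF v r]) (use assms(6) in simp)
  have "strong_duality ?P"
    unfolding strong_duality_def primal dual
    by (simp add: primal_objective_trace_sdp primal(2) dual_objective_diag_dual)
  moreover have "surjective_constraint_map ?P"
    using r by (intro surjective_constraint_map_trace_sdp[OF v]) auto
  moreover have "rank (dual_slack ?P (diag_dual r)) = card {r+1..CARD('n)}"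
    unfolding dual_slack_diag_dual[OF v r] by (rule rank_sum_outer[OF v]) auto
  then have "strict_complementarity ?P"
    unfolding strict_complementarity_def primal dual using assms(2) r by simp
  ultimately show ?thesis
    by (simp add: simple_sdp_def standard_form_trace_sdp primal dual)
qed

end
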